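(* Let $k$ be a natural number and let $P_k(x)$ be the characteristic polynomial of the minimal homogeneous linear recurrence with integer coefficients satisfied by the sequence $\{S(\sigma_{n,k})\}_{n\in\mathbb{N}}$, where $S(\sigma_{n,k})=\sum_{j=0}^n(-1)^{\binom{j}{k}}\binom{n}{j}$. Let $\bar{k}=2\lfloor k/2\rfloor+1$, with binary expansion $\bar{k}=1+2^{a_1}+2^{a_2}+\cdots+2^{a_l}$, $1\le a_1<\cdots<a_l$, so that $a_l=\lfloor\log_2(\bar k)\rfloor$. Then $$P_k(x)=(x-2)^{\epsilon(k)}\prod_{j=1}^l\Phi_{2^{a_j+1}}(x-1),$$ where $\epsilon(k)=0$ if $k$ is a power of $2$ and $\epsilon(k)=1$ otherwise. In particular, the degree of the minimal linear recurrence that $\{S(\sigma_{n,k})\}_{n\in\mathbb{N}}$ satisfies is $2\lfloor k/2\rfloor+\epsilon(k)$.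
   Context: $\mathbb{N}=\{1,2,3,\dots\}$. $S(\sigma_{n,k})$ is the exponential sum $\sum_{x\in\mathbb{F}_2^n}(-1)^{\sigma_{n,k}(x)}$ of the elementary symmetric polynomial of degree $k$ in $n$ variables, and it is defined for all $n$ by the displayed binomial sum. $\Phi_m$ denotes the $m$-th cyclotomic polynomial. A homogeneous linear recurrence $x_n=\sum_{i=1}^D a_ix_{n-i}$ with $a_i\in\mathbb{Z}$ has characteristic polynomial $x^D-\sum_{i=1}^D a_ix^{D-i}$; "minimal" means of least order $D$. *)

theory Defs
  imports Complex_Main "HOL-Computational_Algebra.Polynomial"
begin

text \<open>\<open>exp_sum_sigma k n\<close> is the exponential sum of the elementary symmetric polynomial of
  degree \<open>k\<close> over \<open>F\<^sub>2\<^sup>n\<close>: that polynomial takes the value \<open>j choose k\<close> (mod 2) at each of the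
  \<open>n choose j\<close> vectors of weight \<open>j\<close>.\<close>

definition exp_sum_sigma :: "nat \<Rightarrow> nat \<Rightarrow> int" where
  "exp_sum_sigma k n = (\<Sum>j=0..n. (-1) ^ (j choose k) * int (n choose j))"

text \<open>Sequences are indexed by \<open>1, 2, 3, \<dots>\<close>; their value at 0 is ignored, so a recurrence of
  order \<open>D\<close> is required exactly for \<open>n > D\<close>. Only the coefficients \<open>c 1, \<dots>, c D\<close> matter. Order 0
  is admitted: it says that the sequence vanishes on the positive integers, and its
  characteristic polynomial is 1.\<close>

definition satisfies_recurrence :: "(nat \<Rightarrow> int) \<Rightarrow> nat \<Rightarrow> (nat \<Rightarrow> int) \<Rightarrow> bool" where
  "satisfies_recurrence x D c \<longleftrightarrow> (\<forall>n>D. x n = (\<Sum>i=1..D. c i * x (n - i)))"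

definition minimal_recurrence :: "(nat \<Rightarrow> int) \<Rightarrow> nat \<Rightarrow> (nat \<Rightarrow> int) \<Rightarrow> bool" where
  "minimal_recurrence x D c \<longleftrightarrow>
     satisfies_recurrence x D c \<and> (\<forall>D' c'. satisfies_recurrence x D' c' \<longrightarrow> D \<le> D')"

definition recurrence_char_poly :: "nat \<Rightarrow> (nat \<Rightarrow> int) \<Rightarrow> int poly" where
  "recurrence_char_poly D c = monom 1 D - (\<Sum>i=1..D. monom (c i) (D - i))"

definition cyclotomic_poly :: "nat \<Rightarrow> complex poly" where
  "cyclotomic_poly m =
     (\<Prod>j | j \<in> {1..m} \<and> coprime j m. [:- cis (2 * pi * real j / real m), 1:])"

definition eps :: "nat \<Rightarrow> nat" where
  "eps k = (if \<exists>m. k = 2 ^ m then 0 else 1)"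

text \<open>\<open>b 1 < \<dots> < b l\<close> are the positive exponents in the binary expansion of the odd number \<open>N\<close>.\<close>

definition odd_binary_expansion :: "nat \<Rightarrow> nat \<Rightarrow> (nat \<Rightarrow> nat) \<Rightarrow> bool" where
  "odd_binary_expansion N l b \<longleftrightarrow>
     (\<forall>j\<in>{1..l}. 1 \<le> b j) \<and> strict_mono_on {1..l} b \<and> N = 1 + (\<Sum>j=1..l. 2 ^ b j)"

end

theory Submission
  imports Defs
begin

text \<open>The sequence \<open>(-1) ^ (j choose k)\<close> has period \<open>N = 2 ^ r\<close> in \<open>j\<close> as soon as \<open>k < 2 ^ r\<close>, so it is a
  combination of the characters \<open>z ^ j\<close> with \<open>z ^ N = 1\<close>, and summing against the binomial
  coefficients turns it into \<open>S n = (\<Sum>z. c z * (1 + z) ^ n)\<close>. Lucas' theorem modulo 2 writes the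
  Fourier transform of the parity of \<open>j choose k\<close> as a product over the binary digits of \<open>k\<close>, from
  which one reads off that \<open>c z \<noteq> 0\<close> at a primitive \<open>2 ^ (b + 1)\<close>-th root of unity exactly if
  digit \<open>b\<close> of \<open>k\<close> is 1, and that \<open>c 1 \<noteq> 0\<close> exactly if \<open>k\<close> is not a power of 2. The term
  \<open>z = -1\<close> vanishes for \<open>n \<ge> 1\<close>. A sequence \<open>\<Sum>a. d a * a ^ n\<close> with distinct nonzero \<open>a\<close> and
  nonzero \<open>d a\<close> satisfies a recurrence if and only if every \<open>a\<close> is a root of its characteristic
  polynomial.\<close>

subsection \<open>Binomial coefficients modulo 2\<close>

text \<open>Modulo 2, \<open>(1 + x)^(2n)\<close> is \<open>(1 + x^2)^n\<close>. The induction goes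
  down two rows of Pascal's triangle at a time, where the middle entry counts twice.\<close>

lemma odd_binomial_double:
  "odd (2 * n choose (2 * k)) \<longleftrightarrow> odd (n choose k)" "even (2 * n choose Suc (2 * k))"
proof (induction n arbitrary: k)
  case 0
  { case 1 show ?case by (cases k) auto }
  { case 2 show ?case by auto }
next
  case (Suc n)
  { case 1 show ?case using Suc.IH(1)[of k] Suc.IH(1)[of "k - 1"] Suc.IH(2) 
     by (cases k) auto }
  { case 2 show ?case using Suc.IH(2)[of k] Suc.IH(2)[of "k - 1"]
     by (cases k) auto }
qed

lemma odd_binomial_Suc_double:
  "odd (Suc (2 * n) choose (2 * k)) \<longleftrightarrow> odd (n choose k)"
  "odd (Suc (2 * n) choose Suc (2 * k)) \<longleftrightarrow> odd (n choose k)"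
proof -
  show "odd (Suc (2 * n) choose Suc (2 * k)) \<longleftrightarrow> odd (n choose k)"
    using odd_binomial_double[of n k] by simp
  show "odd (Suc (2 * n) choose (2 * k)) \<longleftrightarrow> odd (n choose k)"
    using odd_binomial_double(1)[of n k] odd_binomial_double(2)[of n "k - 1"] by (cases k) auto
qed

text \<open>The number \<open>k\<close> has only \<open>r\<close> binary digits, so digits of
  \<open>t\<close> from position \<open>r\<close> on cannot affect the parity. The induction strips
  the last digit of \<open>t\<close> and \<open>k\<close>.\<close>

lemma odd_binomial_add_power2:
  assumes "k < 2 ^ r"
  shows "odd ((t + 2 ^ r) choose k) \<longleftrightarrow> odd (t choose k)"
  using assms
proof (induction r arbitrary: t k)
  case 0
  then show ?case by simp
next
  case (Suc r)
  define t' k' where "t' = t div 2" and "k' = k div 2"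
  have IH: "odd ((t' + 2 ^ r) choose k') \<longleftrightarrow> odd (t' choose k')"
    using Suc by (intro Suc.IH) (auto simp: k'_def)
  have t: "t = 2 * t' \<and> t + 2 ^ Suc r = 2 * (t' + 2 ^ r) \<or>
      t = Suc (2 * t') \<and> t + 2 ^ Suc r = Suc (2 * (t' + 2 ^ r))"
    unfolding t'_def power_Suc by presburger
  have k: "k = 2 * k' \<or> k = Suc (2 * k')"
    unfolding k'_def by presburger
  show ?case
    using t k IH odd_binomial_double odd_binomial_Suc_double by (elim disjE conjE) metis+
qed

lemma odd_binomial_mod_power2:
  assumes "k < 2 ^ r"
  shows "odd ((t mod 2 ^ r) choose k) \<longleftrightarrow> odd (t choose k)"
proof -
  have "odd ((s + 2 ^ r * q) choose k) \<longleftrightarrow> odd (s choose k)" for s q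
  proof (induction q)
    case (Suc q)
    then show ?case
      using odd_binomial_add_power2[OF assms, of "s + 2 ^ r * q"] by (simp add: add_ac)
  qed simp
  from this[of "t mod 2 ^ r" "t div 2 ^ r"] show ?thesis by simp
qed

lemma sum_double_split:
  fixes f :: "nat \<Rightarrow> 'a::comm_monoid_add"
  shows "(\<Sum>t<2 * n. f t) = (\<Sum>t<n. f (2 * t) + f (Suc (2 * t)))"
  by (induction n) (simp_all add: add.assoc)

text \<open>By Lucas, \<open>t choose k\<close> is odd iff \<open>t\<close> has digit 1 wherever
  \<open>k\<close> does. Digit \<open>b\<close> of \<open>t\<close> is thus forced if
  \<open>bit k b\<close> and free otherwise, so the sum over \<open>t\<close> factors over the
  digits.\<close>

lemma sum_odd_binomial_power:
  fixes w :: "'a::comm_ring_1"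
  assumes "k < 2 ^ r"
  shows "(\<Sum>t<2 ^ r. of_bool (odd (t choose k)) * w ^ t) =
    (\<Prod>b<r. if bit k b then w ^ 2 ^ b else 1 + w ^ 2 ^ b)"
  using assms
proof (induction r arbitrary: k w)
  case 0
  then show ?case by simp
next
  case (Suc r)
  define k' where "k' = k div 2"
  \<comment> \<open>The factor of the lowest digit; the remaining digits see
    \<open>w\<^sup>2\<close> in place of \<open>w\<close>.\<close>
  define v where "v = (if odd k then w else 1 + w)"
  have IH: "(\<Sum>t<2 ^ r. of_bool (odd (t choose k')) * (w\<^sup>2) ^ t) =
      (\<Prod>b<r. if bit k' b then (w\<^sup>2) ^ 2 ^ b else 1 + (w\<^sup>2) ^ 2 ^ b)"
    using Suc by (intro Suc.IH) (auto simp: k'_def)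
  have k: "k = 2 * k' \<and> v = 1 + w \<or> k = Suc (2 * k') \<and> v = w"
    unfolding k'_def v_def by (cases "even k") auto
  have "of_bool (odd (2 * t choose k)) * w ^ (2 * t) +
      of_bool (odd (Suc (2 * t) choose k)) * w ^ Suc (2 * t) =
      v * (of_bool (odd (t choose k')) * (w\<^sup>2) ^ t)" for t
    using k
    by (elim disjE conjE)
      (simp_all add: odd_binomial_double odd_binomial_Suc_double power_mult distrib_left distrib_right
        mult.left_commute del: binomial_Suc_Suc)
  then have "(\<Sum>t<2 ^ Suc r. of_bool (odd (t choose k)) * w ^ t) =
      v * (\<Sum>t<2 ^ r. of_bool (odd (t choose k')) * (w\<^sup>2) ^ t)"
    by (simp add: sum_double_split sum_distrib_left
        del: binomial_Suc_Suc sum_mult_of_bool_eq sum_of_bool_mult_eq)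
  also have "\<dots> = (\<Prod>b<Suc r. if bit k b then w ^ 2 ^ b else 1 + w ^ 2 ^ b)"
    unfolding IH unfolding prod.lessThan_Suc_shift k'_def v_def
    by (simp add: bit_0 bit_Suc flip: power_mult cong: if_cong)
  finally show ?case .
qed

subsection \<open>Fourier expansion of periodic sequences\<close>

text \<open>Orthogonality of characters: along the powers of a primitive root the sum is geometric
  with ratio \<open>q\<close>, an \<open>n\<close>-th root of unity that equals 1 only for
  \<open>j = t\<close>.\<close>

lemma sum_roots_unity_power_mult_inverse:
  assumes "j < n" "t < n"
  shows "(\<Sum>z | z ^ n = (1::complex). z ^ j * inverse z ^ t) = (if j = t then of_nat n else 0)"
proof -
  define w where "w m = cis (2 * pi * real m / real n)" for m :: nat
  have bij: "bij_betw w {..<n} {z. z ^ n = 1}"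
    unfolding w_def using assms by (intro bij_betw_roots_unity) auto
  have [simp]: "w m \<noteq> 0" "w m ^ n = 1" if "m < n" for m
    using bij_betwE[OF bij] that by (auto simp: w_def)
  have wpow: "w m = w 1 ^ m" for m
    by (simp add: w_def DeMoivre mult_ac)
  define q where "q = w 1 ^ j * inverse (w 1) ^ t"
  have w1: "w 1 ^ n = 1" "w 1 \<noteq> 0"
    using assms by (auto simp: w_def DeMoivre)
  have "(\<Sum>z | z ^ n = 1. z ^ j * inverse z ^ t) = (\<Sum>m<n. w m ^ j * inverse (w m) ^ t)"
    by (rule sum.reindex_bij_betw[OF bij, symmetric])
  also have "\<dots> = (\<Sum>m<n. q ^ m)"
  proof (intro sum.cong refl)
    fix m
    show "w m ^ j * inverse (w m) ^ t = q ^ m"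
      unfolding q_def wpow[of m]
      by (simp add: power_mult_distrib power_inverse mult.commute flip: power_mult)
  qed
  also have "\<dots> = (if j = t then of_nat n else 0)"
  proof (cases "j = t")
    case True
    then have "q = 1" using w1 by (simp add: q_def flip: power_mult_distrib)
    then show ?thesis using True by simp
  next
    case False
    then have "w j \<noteq> w t"
      using bij assms by (auto simp: bij_betw_def inj_on_def)
    then have "q \<noteq> 1"
      using w1 by (auto simp: q_def wpow[of j] wpow[of t] field_simps)
    moreover have "q ^ n = (w 1 ^ n) ^ j * inverse (w 1 ^ n) ^ t"
      by (simp add: q_def power_mult_distrib power_inverse mult.commute flip: power_mult)
    ultimately show ?thesis using False w1 by (simp add: sum_gp_strict)
  qed
  finally show ?thesis .
qed

text \<open>Discrete Fourier transform at the \<open>n\<close>-th roots of unity, normalised so that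
  the inversion formula carries no factor.\<close>

definition fourier_coeff :: "nat \<Rightarrow> (nat \<Rightarrow> complex) \<Rightarrow> complex \<Rightarrow> complex" where
  "fourier_coeff n f z = (\<Sum>t<n. f t * inverse z ^ t) / of_nat n"

lemma fourier_inversion:
  assumes "n > 0" and "\<And>t. f (t mod n) = f t"
  shows "f j = (\<Sum>z | z ^ n = 1. fourier_coeff n f z * z ^ j)"
proof -
  \<comment> \<open>Orthogonality needs exponents below \<open>n\<close>, so \<open>j\<close> is
    first reduced modulo \<open>n\<close>.\<close>
  have "z ^ j = z ^ (j mod n)" if "z ^ n = 1" for z :: complex
  proof -
    have "z ^ j = (z ^ n) ^ (j div n) * z ^ (j mod n)"
      by (simp flip: power_mult power_add)
    then show ?thesis using that by simp
  qed
  then have "(\<Sum>z | z ^ n = 1. fourier_coeff n f z * z ^ j) =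
      (\<Sum>z | z ^ n = 1. fourier_coeff n f z * z ^ (j mod n))"
    by (intro sum.cong) auto
  also have "\<dots> = (\<Sum>z | z ^ n = 1. \<Sum>t<n. f t / of_nat n * (z ^ (j mod n) * inverse z ^ t))"
    by (simp add: fourier_coeff_def sum_distrib_left sum_divide_distrib mult_ac)
  also have "\<dots> = (\<Sum>t<n. f t / of_nat n * (\<Sum>z | z ^ n = 1. z ^ (j mod n) * inverse z ^ t))"
    by (subst sum.swap) (simp add: sum_distrib_left)
  also have "\<dots> = (\<Sum>t<n. f t / of_nat n * (if j mod n = t then of_nat n else 0))"
    using assms(1) by (intro sum.cong refl) (simp add: sum_roots_unity_power_mult_inverse)
  also have "\<dots> = (\<Sum>t<n. if j mod n = t then f t else 0)"
    using assms(1) by (intro sum.cong) auto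
  also have "\<dots> = f j"
    using assms by simp
  finally show ?thesis by simp
qed

text \<open>Expand \<open>f\<close> in characters, exchange the sums and apply the binomial theorem
  to each character.\<close>

lemma sum_periodic_mult_binomial:
  assumes "m > 0" and "\<And>t. f (t mod m) = f t"
  shows "(\<Sum>j\<le>n. f j * of_nat (n choose j)) =
    (\<Sum>z | z ^ m = 1. fourier_coeff m f z * (1 + z) ^ n)"
proof -
  have "(\<Sum>j\<le>n. f j * of_nat (n choose j)) =
      (\<Sum>j\<le>n. \<Sum>z | z ^ m = 1. fourier_coeff m f z * (of_nat (n choose j) * z ^ j))"
    by (subst fourier_inversion[of m f, OF assms])
      (simp_all add: sum_distrib_left sum_distrib_right mult_ac)
  also have "\<dots> = (\<Sum>z | z ^ m = 1. fourier_coeff m f z * (\<Sum>j\<le>n. of_nat (n choose j) * z ^ j))"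
    by (subst sum.swap) (simp add: sum_distrib_left)
  also have "\<dots> = (\<Sum>z | z ^ m = 1. fourier_coeff m f z * (1 + z) ^ n)"
    using binomial_ring[of _ "1::complex"] by (simp add: add.commute)
  finally show ?thesis .
qed

section \<open>Roots of unity of 2-power order\<close>

text \<open>Each \<open>z ^ 2 ^ c\<close> is a square root of the next one, so descending from 1 the
  first value other than 1 is -1.\<close>

lemma root_unity_power2_cases:
  fixes z :: "'a::idom"
  assumes "z ^ 2 ^ r = 1" "z \<noteq> 1"
  obtains b where "b < r" "z ^ 2 ^ b = -1"
  using assms
proof (induction r arbitrary: thesis)
  case (Suc r)
  have "(z ^ 2 ^ r)\<^sup>2 = 1"
    using Suc.prems(2) by (simp add: mult.commute flip: power_mult)
  then consider "z ^ 2 ^ r = 1" | "z ^ 2 ^ r = -1"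
    by (auto simp: power2_eq_1_iff)
  then show ?case
  proof cases
    case 1
    then show ?thesis using Suc.IH Suc.prems by (metis less_Suc_eq)
  next
    case 2
    then show ?thesis using Suc.prems(1) by blast
  qed
qed simp

lemma power2_power_eq_1:
  fixes z :: "'a::ring_1"
  assumes "z ^ 2 ^ b = -1" "b < r"
  shows "z ^ 2 ^ r = 1"
proof -
  from assms(2) obtain d where "r = Suc b + d"
    using less_iff_Suc_add by auto
  then have "z ^ 2 ^ r = ((z ^ 2 ^ b)\<^sup>2) ^ 2 ^ d"
    by (simp add: power_add mult_ac flip: power_mult)
  then show ?thesis using assms(1) by simp
qed

text \<open>For \<open>b < c\<close>, repeated squaring of -1 gives \<open>z ^ 2 ^ c = 1\<close>,
  which is not -1 in characteristic 0.\<close>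

lemma power2_power_minus_one_unique:
  fixes z :: "'a::ring_char_0"
  assumes "z ^ 2 ^ b = -1" "z ^ 2 ^ c = -1"
  shows "b = c"
proof -
  have "\<not> b < c" if "z ^ 2 ^ b = -1" "z ^ 2 ^ c = -1" for b c
    using power2_power_eq_1[OF that(1), of c] that(2) by auto
  then show ?thesis using assms by (meson linorder_neqE_nat)
qed

section \<open>Fourier coefficients of the sign sequence\<close>

definition sign_binomial :: "nat \<Rightarrow> nat \<Rightarrow> complex" where
  "sign_binomial k t = (-1) ^ (t choose k)"

lemma sign_binomial_eq: "sign_binomial k t = 1 - 2 * of_bool (odd (t choose k))"
  by (simp add: sign_binomial_def)

lemma sum_sign_binomial:
  assumes "k < 2 ^ r"
  shows "(\<Sum>t<2 ^ r. sign_binomial k t * w ^ t) =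
    (\<Sum>t<2 ^ r. w ^ t) - 2 * (\<Prod>b<r. if bit k b then w ^ 2 ^ b else 1 + w ^ 2 ^ b)"
  unfolding sum_odd_binomial_power[OF assms, symmetric] sign_binomial_eq
  by (simp add: left_diff_distrib sum_subtractf sum_distrib_left mult.assoc
      del: sum_mult_of_bool_eq sum_of_bool_mult_eq)

text \<open>For \<open>z \<noteq> 1\<close> the geometric sum vanishes and only the digit product
  remains. Its factor at a digit 1 of \<open>k\<close> is a power of \<open>inverse z\<close>, hence
  nonzero; at a digit 0 in position \<open>c\<close> it vanishes iff \<open>z ^ 2 ^ c = -1\<close>,
  that is, iff \<open>c = b\<close>.\<close>

lemma fourier_coeff_sign_binomial_neq_0_iff:
  assumes "k < 2 ^ r" "z ^ 2 ^ b = -1" "b < r"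
  shows "fourier_coeff (2 ^ r) (sign_binomial k) z \<noteq> 0 \<longleftrightarrow> bit k b"
proof -
  have z: "z ^ 2 ^ r = 1" "z \<noteq> 1" "z \<noteq> 0"
    using power2_power_eq_1[OF assms(2,3)] assms(2) by (auto simp: power_0_left)
  then have "(\<Sum>t<2 ^ r. inverse z ^ t) = 0"
    using sum_gp_strict[of "inverse z" "2 ^ r"] by (simp add: power_inverse)
  then have "fourier_coeff (2 ^ r) (sign_binomial k) z \<noteq> 0 \<longleftrightarrow>
      (\<Prod>c<r. if bit k c then inverse z ^ 2 ^ c else 1 + inverse z ^ 2 ^ c) \<noteq> 0"
    by (simp add: fourier_coeff_def sum_sign_binomial[OF assms(1)] del: prod_zero_iff)
  also have "\<dots> \<longleftrightarrow> (\<forall>c<r. z ^ 2 ^ c = -1 \<longrightarrow> bit k c)"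
  proof -
    have "1 + inverse z ^ 2 ^ c = 0 \<longleftrightarrow> z ^ 2 ^ c = -1" for c
      using z(3) by (simp add: power_inverse field_simps add_eq_0_iff)
    then show ?thesis using z(3) by (auto split: if_splits)
  qed
  also have "\<dots> \<longleftrightarrow> bit k b"
    using assms(2,3) power2_power_minus_one_unique[OF assms(2)] by metis
  finally show ?thesis .
qed

text \<open>At 1 the geometric sum is \<open>2 ^ r\<close>, and the digit product is 2 to the number
  of digits 0 of \<open>k\<close> below \<open>r\<close>. Twice the product cancels the sum iff
  \<open>k\<close> has exactly one digit 1.\<close>

lemma fourier_coeff_sign_binomial_1_neq_0_iff:
  assumes "k < 2 ^ r" "k > 0"
  shows "fourier_coeff (2 ^ r) (sign_binomial k) 1 \<noteq> 0 \<longleftrightarrow> (\<nexists>m. k = 2 ^ m)"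
proof -
  define K where "K = {b\<in>{..<r}. bit k b}"
  have [simp]: "finite K" "card K \<le> r" 
    using card_mono[of "{..<r}" K] by (auto simp: K_def)
  have bits: "bit k b \<longleftrightarrow> b \<in> K" for b
  proof -
    have "b < r" if "bit k b"
      using assms(1) that by (metis bit_take_bit_iff take_bit_nat_eq_self)
    then show ?thesis by (auto simp: K_def)
  qed
  have "(\<Prod>b<r. if bit k b then 1 ^ 2 ^ b else 1 + 1 ^ 2 ^ b) = (2::complex) ^ (r - card K)"
  proof -
    have "{..<r} \<inter> - {b. bit k b} = {..<r} - K" by (auto simp: K_def)
    moreover have "card ({..<r} - K) = r - card K"
      by (subst card_Diff_subset) (auto simp: K_def)
    ultimately show ?thesis
      by (simp add: prod.If_cases)
  qed
  then have "fourier_coeff (2 ^ r) (sign_binomial k) 1 = 0 \<longleftrightarrow>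
      (2::complex) ^ r = 2 ^ Suc (r - card K)"
    using sum_sign_binomial[OF assms(1), of 1] by (simp add: fourier_coeff_def)
  also have "\<dots> \<longleftrightarrow> (2::nat) ^ r = 2 ^ Suc (r - card K)"
    using of_nat_eq_iff[of "2 ^ r" "2 ^ Suc (r - card K)", where 'a = complex] by simp
  also have "\<dots> \<longleftrightarrow> r = Suc (r - card K)"
    by (rule power_inject_exp) simp
  also have "\<dots> \<longleftrightarrow> card K = 1"
  proof -
    have "r > 0" using assms by (cases r) auto
    then show ?thesis using \<open>card K \<le> r\<close> by linarith
  qed
  also have "\<dots> \<longleftrightarrow> (\<exists>m. K = {m})"
    by (simp add: card_1_singleton_iff)
  also have "\<dots> \<longleftrightarrow> (\<exists>m. k = 2 ^ m)"
  proof (intro ex_cong1)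
    fix m
    have "k = 2 ^ m \<longleftrightarrow> (\<forall>b. bit k b \<longleftrightarrow> bit (2 ^ m :: nat) b)"
      by (auto intro: bit_eqI)
    also have "\<dots> \<longleftrightarrow> K = {m}"
      by (auto simp: bits bit_exp_iff)
    finally show "K = {m} \<longleftrightarrow> k = 2 ^ m" by simp
  qed
  finally show ?thesis by simp
qed

subsection \<open>Recurrences of exponential sums\<close>

lemma coeff_recurrence_char_poly:
  "coeff (recurrence_char_poly D c) n = (if n = D then 1 else if n < D then - c (D - n) else 0)"
proof -
  have "(\<Sum>i=1..D. coeff (monom (c i) (D - i)) n) =
      (\<Sum>i=1..D. if i = D - n then (if n < D then c (D - n) else 0) else 0)"
    by (intro sum.cong) auto
  then show ?thesis
    by (auto simp: recurrence_char_poly_def coeff_sum)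
qed

lemma degree_recurrence_char_poly: "degree (recurrence_char_poly D c) = D"
  by (intro antisym degree_le le_degree) (auto simp: coeff_recurrence_char_poly)

lemma lead_coeff_recurrence_char_poly: "lead_coeff (recurrence_char_poly D c) = 1"
  by (simp add: degree_recurrence_char_poly coeff_recurrence_char_poly)

text \<open>Reads a recurrence off a monic integer polynomial; this is how the minimal recurrence is
  constructed.\<close>

lemma recurrence_char_poly_of_monic:
  assumes "lead_coeff p = 1"
  shows "recurrence_char_poly (degree p) (\<lambda>i. - coeff p (degree p - i)) = p"
  using assms by (intro poly_eqI) (auto simp: coeff_recurrence_char_poly coeff_eq_0)

text \<open>The right side is the amount by which the sequence \<open>z ^ n\<close> fails the
  recurrence at \<open>n\<close>.\<close>

lemma poly_recurrence_char_poly_mult_power: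
  fixes z :: "'a::comm_ring_1"
  assumes "D \<le> n"
  shows "poly (map_poly of_int (recurrence_char_poly D c)) z * z ^ (n - D) =
    z ^ n - (\<Sum>i=1..D. of_int (c i) * z ^ (n - i))"
proof -
  have "map_poly of_int (recurrence_char_poly D c) =
      monom (1::'a) D - (\<Sum>i=1..D. monom (of_int (c i)) (D - i))"
    by (intro poly_eqI)
      (auto simp: recurrence_char_poly_def coeff_map_poly coeff_sum intro!: sum.cong)
  moreover have "z ^ (D - i) * z ^ (n - D) = z ^ (n - i)" if "i \<le> D" for i
    using that assms by (simp flip: power_add)
  ultimately show ?thesis
    using assms
    by (auto simp: poly_sum poly_monom left_diff_distrib sum_distrib_right mult.assoc
        simp flip: power_add intro!: sum.cong)
qed

section \<open>Polynomials with prescribed simple roots\<close>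

text \<open>Split off one root by the factor theorem; the quotient still vanishes at the other
  elements because they are distinct from it.\<close>

lemma prod_linear_dvd_iff:
  fixes p :: "'a::field poly"
  assumes "finite A"
  shows "(\<Prod>a\<in>A. [:-a, 1:]) dvd p \<longleftrightarrow> (\<forall>a\<in>A. poly p a = 0)"
  using assms
proof (induction A arbitrary: p rule: finite_induct)
  case (insert a A)
  show ?case
  proof
    assume "(\<Prod>a\<in>insert a A. [:-a, 1:]) dvd p"
    then show "\<forall>a\<in>insert a A. poly p a = 0"
      using insert.hyps by (auto simp: dvd_def poly_prod)
  next
    assume *: "\<forall>a\<in>insert a A. poly p a = 0"
    then obtain q where q: "p = [:-a, 1:] * q"
      by (auto simp: poly_eq_0_iff_dvd dvd_def)
    have "\<forall>b\<in>A. poly q b = 0"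
      using * insert.hyps by (auto simp: q)
    then show "(\<Prod>a\<in>insert a A. [:-a, 1:]) dvd p"
      unfolding q prod.insert[OF insert.hyps] insert.IH[symmetric] by (intro mult_dvd_mono dvd_refl)
  qed
qed simp

lemma degree_prod_linear: "degree (\<Prod>a\<in>A. [:-a, 1 :: 'a::idom:]) = card A"
  by (simp add: degree_prod_sum_eq)

lemma lead_coeff_prod_linear: "lead_coeff (\<Prod>a\<in>A. [:-a, 1 :: 'a::idom:]) = 1"
  by (simp add: lead_coeff_prod)

lemma monic_dvd_imp_eq:
  fixes p q :: "'a::idom poly"
  assumes "p dvd q" "lead_coeff p = 1" "lead_coeff q = 1" "degree q \<le> degree p"
  shows "q = p"
proof -
  obtain r where r: "q = p * r" using assms(1) by (auto simp: dvd_def)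
  have "p \<noteq> 0" "r \<noteq> 0" using assms(2,3) r by auto
  then have "degree r = 0" using assms(4) by (simp add: r degree_mult_eq)
  moreover have "lead_coeff r = 1" using assms(2,3) by (simp add: r lead_coeff_mult)
  ultimately have "r = 1" by (metis degree_eq_zeroE lead_coeff_pCons(2) one_pCons)
  then show ?thesis by (simp add: r)
qed

lemma monic_eq_prod_linear:
  fixes p :: "'a::field poly"
  assumes "finite A" "lead_coeff p = 1" "degree p = card A" "\<And>a. a \<in> A \<Longrightarrow> poly p a = 0"
  shows "p = (\<Prod>a\<in>A. [:-a, 1:])"
proof (rule monic_dvd_imp_eq)
  show "(\<Prod>a\<in>A. [:-a, 1:]) dvd p"
    using assms(1,4) by (simp add: prod_linear_dvd_iff)
  show "lead_coeff (\<Prod>a\<in>A. [:-a, 1:]) = 1"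
    by (rule lead_coeff_prod_linear)
qed (use assms in \<open>simp_all add: degree_prod_linear\<close>)

section \<open>Sums of exponentials and their recurrences\<close>

text \<open>A polynomial without constant term gives a linear combination of the vanishing sums;
  choosing it to vanish on \<open>A\<close> except at one point isolates the coefficient
  there.\<close>

lemma exponential_sum_eq_0_iff:
  fixes d :: "'a::field \<Rightarrow> 'a"
  assumes "finite A" "0 \<notin> A"
  shows "(\<forall>n\<ge>1. (\<Sum>a\<in>A. d a * a ^ n) = 0) \<longleftrightarrow> (\<forall>a\<in>A. d a = 0)"
proof safe
  fix a
  assume *: "\<forall>n\<ge>1. (\<Sum>a\<in>A. d a * a ^ n) = 0" and a: "a \<in> A"
  \<comment> \<open>The factor \<open>x\<close> removes the constant term, as nothing is known at
    \<open>n = 0\<close>; \<open>0 \<notin> A\<close> keeps \<open>q\<close> nonzero at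
    \<open>a\<close>.\<close>
  define q where "q = pCons 0 (\<Prod>b\<in>A - {a}. [:-b, 1:])"
  have "(\<Sum>b\<in>A. d b * poly q b) = (\<Sum>b\<in>A. \<Sum>i\<le>degree q. coeff q i * (d b * b ^ i))"
    by (simp add: poly_altdef sum_distrib_left mult_ac)
  also have "\<dots> = (\<Sum>i\<le>degree q. coeff q i * (\<Sum>b\<in>A. d b * b ^ i))"
    by (subst sum.swap) (simp add: sum_distrib_left)
  also have "\<dots> = 0"
  proof (intro sum.neutral ballI)
    fix i
    show "coeff q i * (\<Sum>b\<in>A. d b * b ^ i) = 0"
      using * by (cases i) (auto simp: q_def)
  qed
  also have "(\<Sum>b\<in>A. d b * poly q b) = (\<Sum>b\<in>A. if b = a then d a * poly q a else 0)"
    using assms(1) by (intro sum.cong) (auto simp: q_def poly_prod)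
  also have "\<dots> = d a * poly q a"
    using assms(1) a by simp
  finally show "d a = 0"
    using assms a by (auto simp: q_def poly_prod)
qed simp

text \<open>By linearity the sequence fails the recurrence by a sum of exponentials with
  coefficients \<open>d a * poly ?P a\<close>, which is identically zero only if \<open>?P\<close>
  vanishes on \<open>A\<close>.\<close>

lemma satisfies_recurrence_iff_dvd:
  fixes x :: "nat \<Rightarrow> int" and A :: "'a::field_char_0 set"
  assumes "finite A" "0 \<notin> A" "\<And>a. a \<in> A \<Longrightarrow> d a \<noteq> 0"
    and x: "\<And>n. n \<ge> 1 \<Longrightarrow> of_int (x n) = (\<Sum>a\<in>A. d a * a ^ n)"
  shows "satisfies_recurrence x D c \<longleftrightarrow>
    (\<Prod>a\<in>A. [:-a, 1:]) dvd map_poly of_int (recurrence_char_poly D c)"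
proof -
  let ?P = "map_poly of_int (recurrence_char_poly D c) :: 'a poly"
  have diff: "of_int (x n - (\<Sum>i=1..D. c i * x (n - i))) =
      (\<Sum>a\<in>A. d a * poly ?P a * a ^ (n - D))" if "n > D" for n
  proof -
    have "of_int (x n - (\<Sum>i=1..D. c i * x (n - i))) =
        (\<Sum>a\<in>A. d a * a ^ n) - (\<Sum>i=1..D. of_int (c i) * (\<Sum>a\<in>A. d a * a ^ (n - i)))"
    proof -
      \<comment> \<open>From \<open>i \<le> D < n\<close> follows \<open>n - i \<ge> 1\<close>, so
        the value \<open>x 0\<close> never enters.\<close>
      have "(\<Sum>i=1..D. of_int (c i) * of_int (x (n - i)) :: 'a) =
          (\<Sum>i=1..D. of_int (c i) * (\<Sum>a\<in>A. d a * a ^ (n - i)))"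
        using that by (intro sum.cong) (auto simp: x)
      then show ?thesis using that by (simp add: x)
    qed
    also have "(\<Sum>i=1..D. of_int (c i) * (\<Sum>a\<in>A. d a * a ^ (n - i))) =
        (\<Sum>a\<in>A. d a * (\<Sum>i=1..D. of_int (c i) * a ^ (n - i)))"
      unfolding sum_distrib_left by (subst sum.swap) (simp add: mult_ac)
    also have "(\<Sum>a\<in>A. d a * a ^ n) - \<dots> = (\<Sum>a\<in>A. d a * (poly ?P a * a ^ (n - D)))"
      using that by (simp add: poly_recurrence_char_poly_mult_power right_diff_distrib
          flip: sum_subtractf)
    finally show ?thesis by (simp add: mult.assoc)
  qed
  then have "x n = (\<Sum>i=1..D. c i * x (n - i)) \<longleftrightarrow>
      (\<Sum>a\<in>A. d a * poly ?P a * a ^ (n - D)) = 0" if "n > D" for n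
  proof -
    have "x n = (\<Sum>i=1..D. c i * x (n - i)) \<longleftrightarrow>
        of_int (x n - (\<Sum>i=1..D. c i * x (n - i))) = (0 :: 'a)"
      by (subst of_int_eq_0_iff) simp
    then show ?thesis by (simp only: diff[OF that])
  qed
  then have "satisfies_recurrence x D c \<longleftrightarrow>
      (\<forall>n>D. (\<Sum>a\<in>A. d a * poly ?P a * a ^ (n - D)) = 0)"
    by (simp add: satisfies_recurrence_def)
  also have "\<dots> \<longleftrightarrow> (\<forall>m\<ge>1. (\<Sum>a\<in>A. d a * poly ?P a * a ^ m) = 0)"
  proof safe
    fix m :: nat assume "\<forall>n>D. (\<Sum>a\<in>A. d a * poly ?P a * a ^ (n - D)) = 0" "m \<ge> 1"
    then show "(\<Sum>a\<in>A. d a * poly ?P a * a ^ m) = 0"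
      by (auto dest!: spec[of _ "m + D"])
  qed simp
  also have "\<dots> \<longleftrightarrow> (\<forall>a\<in>A. poly ?P a = 0)"
    using assms(3) by (subst exponential_sum_eq_0_iff[OF assms(1,2)]) auto
  finally show ?thesis by (simp only: prod_linear_dvd_iff[OF assms(1)])
qed

text \<open>Divisibility forces order at least \<open>card A\<close>. To attain it with integer
  coefficients, the product of linear factors must come from an integer polynomial, here
  \<open>q\<close>.\<close>

lemma minimal_recurrence_exponential_sum:
  fixes x :: "nat \<Rightarrow> int" and A :: "'a::field_char_0 set"
  assumes "finite A" "0 \<notin> A" "\<And>a. a \<in> A \<Longrightarrow> d a \<noteq> 0"
    and x: "\<And>n. n \<ge> 1 \<Longrightarrow> of_int (x n) = (\<Sum>a\<in>A. d a * a ^ n)"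
    and q: "map_poly of_int q = (\<Prod>a\<in>A. [:-a, 1:])"
  shows "\<exists>D c. minimal_recurrence x D c"
    and "minimal_recurrence x D c \<Longrightarrow>
      map_poly of_int (recurrence_char_poly D c) = (\<Prod>a\<in>A. [:-a, 1:]) \<and> D = card A"
proof -
  have iff: "satisfies_recurrence x D c \<longleftrightarrow>
      (\<Prod>a\<in>A. [:-a, 1:]) dvd map_poly of_int (recurrence_char_poly D c)" for D c
    by (rule satisfies_recurrence_iff_dvd[where d = d]) (use assms in auto)
  have deg_map: "degree (map_poly of_int p :: 'a poly) = degree p" for p :: "int poly"
    by (rule degree_map_poly) simp
  have ge: "card A \<le> D" if "satisfies_recurrence x D c" for D c
  proof -
    have "recurrence_char_poly D c \<noteq> 0"
      using lead_coeff_recurrence_char_poly[of D c] by auto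
    then have "map_poly of_int (recurrence_char_poly D c) \<noteq> (0 :: 'a poly)"
      by (simp add: map_poly_eq_0_iff)
    then show ?thesis
      using dvd_imp_degree_le[OF iff[THEN iffD1, OF that]]
      by (simp add: deg_map degree_prod_linear degree_recurrence_char_poly)
  qed
  have deg_q: "degree q = card A"
    using deg_map[of q] by (simp add: q degree_prod_linear)
  have "of_int (lead_coeff q) = (1 :: 'a)"
    using lead_coeff_prod_linear[of A] unfolding q[symmetric] by (simp add: deg_map coeff_map_poly)
  then have "lead_coeff q = 1" by (metis of_int_eq_1_iff)
  then have min: "minimal_recurrence x (card A) (\<lambda>i. - coeff q (card A - i))"
    using recurrence_char_poly_of_monic[of q] ge
    by (simp add: minimal_recurrence_def iff deg_q q)
  then show "\<exists>D c. minimal_recurrence x D c" by blast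
  assume *: "minimal_recurrence x D c"
  then have D: "D = card A"
    using min by (meson antisym minimal_recurrence_def)
  have "map_poly of_int (recurrence_char_poly D c) = (\<Prod>a\<in>A. [:-a, 1:])"
  proof (rule monic_dvd_imp_eq)
    show "(\<Prod>a\<in>A. [:-a, 1:]) dvd map_poly of_int (recurrence_char_poly D c)"
      using * iff by (simp add: minimal_recurrence_def)
    show "lead_coeff (map_poly of_int (recurrence_char_poly D c)) = (1 :: 'a)"
      using lead_coeff_recurrence_char_poly[of D c] by (simp add: deg_map coeff_map_poly)
    show "lead_coeff (\<Prod>a\<in>A. [:-a, 1 :: 'a:]) = 1"
      by (rule lead_coeff_prod_linear)
  qed (simp add: deg_map degree_recurrence_char_poly D degree_prod_linear)
  with D show "map_poly of_int (recurrence_char_poly D c) = (\<Prod>a\<in>A. [:-a, 1:]) \<and> D = card A"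
    by simp
qed

subsection \<open>Cyclotomic polynomials of 2-power order and binary expansions\<close>

text \<open>Both sides are monic of degree \<open>2 ^ n\<close>, and each of the
  \<open>2 ^ n\<close> primitive roots satisfies \<open>z ^ 2 ^ n = -1\<close>.\<close>

lemma cyclotomic_poly_power2: "cyclotomic_poly (2 ^ Suc n) = monom 1 (2 ^ n) + 1"
proof -
  define J where "J = {j \<in> {1..2 ^ Suc n}. coprime j (2 ^ Suc n :: nat)}"
  define w where "w j = cis (2 * pi * real j / real (2 ^ Suc n))" for j :: nat
  \<comment> \<open>The units modulo a power of 2 are the odd residues.\<close>
  have J: "J = (\<lambda>i. Suc (2 * i)) ` {..<2 ^ n}"
    by (auto simp: J_def elim!: oddE)
  have card_J: "card J = 2 ^ n"
    unfolding J by (subst card_image) (auto simp: inj_on_def)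
  have "inj_on w {..<2 ^ Suc n}"
    using bij_betw_roots_unity[of "2 ^ Suc n"] unfolding w_def bij_betw_def by auto
  then have inj: "inj_on w J"
    by (rule inj_on_subset) (auto simp: J)
  have "cyclotomic_poly (2 ^ Suc n) = (\<Prod>j\<in>J. [:- w j, 1:])"
    by (simp add: cyclotomic_poly_def J_def w_def)
  also have "\<dots> = (\<Prod>z\<in>w ` J. [:- z, 1:])"
    using inj by (simp add: prod.reindex)
  also have "\<dots> = monom 1 (2 ^ n) + 1"
  proof (rule monic_eq_prod_linear[symmetric])
    have deg: "degree (monom (1::complex) (2 ^ n) + 1) = 2 ^ n"
      by (subst degree_add_eq_left) (auto simp: degree_monom_eq)
    then show "degree (monom (1::complex) (2 ^ n) + 1) = card (w ` J)"
      by (simp add: card_image inj card_J)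
    show "lead_coeff (monom (1::complex) (2 ^ n) + 1) = 1"
      by (simp add: deg)
    show "finite (w ` J)" by (simp add: J)
    fix z assume "z \<in> w ` J"
    then obtain i where "z = w (Suc (2 * i))" by (auto simp: J)
    then have "z = cis (pi * real (Suc (2 * i)) / 2 ^ n)" by (simp add: w_def)
    then have "z ^ 2 ^ n = cis (2 * pi * real i + pi)"
      by (simp add: DeMoivre) (simp add: algebra_simps)
    also have "\<dots> = -1"
      using cos_int_2pin[of "int i"] sin_int_2pin[of "int i"] by (simp add: complex_eq_iff)
    finally show "poly (monom 1 (2 ^ n) + 1) z = 0"
      by (simp add: poly_monom)
  qed
  finally show ?thesis .
qed

lemma cyclotomic_poly_power2_shift:
  "pcompose (cyclotomic_poly (2 ^ Suc n)) [:-1, 1:] = [:-1, 1:] ^ 2 ^ n + 1"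
proof -
  have "pcompose (monom 1 m) p = p ^ m" for m and p :: "complex poly"
    by (induction m) (simp_all add: monom_0 monom_Suc pcompose_pCons one_pCons)
  then show ?thesis
    by (simp only: cyclotomic_poly_power2 pcompose_add pcompose_1)
qed

lemma
  assumes "m > 0"
  shows degree_linear_power_add_1: "degree ([:-1, 1::'a::idom:] ^ m + 1) = m"
    and lead_coeff_linear_power_add_1: "lead_coeff ([:-1, 1::'a:] ^ m + 1) = 1"
proof -
  show *: "degree ([:-1, 1::'a:] ^ m + 1) = m"
    using assms by (subst degree_add_eq_left) (simp_all add: degree_linear_power)
  show "lead_coeff ([:-1, 1::'a:] ^ m + 1) = 1"
    using assms unfolding * by (simp add: coeff_linear_power)
qed

section \<open>Binary expansions\<close>

lemma bit_sum_power2: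
  assumes "finite B"
  shows "bit (\<Sum>b\<in>B. 2 ^ b :: nat) n \<longleftrightarrow> n \<in> B"
  using assms
proof (induction B arbitrary: n rule: finite_induct)
  case (insert b B)
  \<comment> \<open>By the induction hypothesis bit \<open>b\<close> is still clear, so adding
    \<open>2 ^ b\<close> sets it.\<close>
  then have "(\<Sum>c\<in>insert b B. 2 ^ c) = set_bit b (\<Sum>c\<in>B. 2 ^ c :: nat)"
    by (simp add: set_bit_eq)
  then show ?case using insert by (auto simp: bit_set_bit_iff)
qed simp

text \<open>The top term bounds \<open>N\<close> from below; from above, the powers
  \<open>2, 4, ..., 2 ^ b l\<close> add up to \<open>2 ^ Suc (b l) - 2\<close>, which leaves room
  for the extra 1.\<close>

lemma floor_log2_binary_expansion:
  assumes "odd_binary_expansion N l b" "l \<ge> 1"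
  shows "\<lfloor>log 2 (real N)\<rfloor> = int (b l)"
proof -
  have mono: "strict_mono_on {1..l} b" and N: "N = 1 + (\<Sum>j=1..l. 2 ^ b j)"
    and pos: "\<forall>j\<in>{1..l}. 1 \<le> b j"
    using assms(1) by (auto simp: odd_binary_expansion_def)
  have "2 ^ b l \<le> (\<Sum>j=1..l. 2 ^ b j :: nat)"
    by (rule member_le_sum) (use assms(2) in auto)
  then have "2 ^ b l \<le> N" by (simp add: N)
  moreover have "N < 2 ^ Suc (b l)"
  proof -
    have "b ` {1..l} \<subseteq> {0<..b l}"
    proof safe
      fix j assume "j \<in> {1..l}"
      then show "b j \<in> {0<..b l}"
        using pos strict_mono_on_leD[OF mono, of j l] assms(2) by fastforce
    qed
    then have "(\<Sum>i\<in>b ` {1..l}. 2 ^ i) \<le> (\<Sum>i\<in>{0<..b l}. 2 ^ i :: nat)"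
      by (intro sum_mono2) auto
    also have "(\<Sum>i\<in>b ` {1..l}. 2 ^ i :: nat) = (\<Sum>j=1..l. 2 ^ b j)"
      by (subst sum.reindex) (use mono in \<open>auto dest: strict_mono_on_imp_inj_on\<close>)
    also have "(\<Sum>i\<in>{0<..m}. 2 ^ i :: nat) + 2 = 2 ^ Suc m" for m
    proof (induction m)
      case (Suc m)
      have "{0<..Suc m} = insert (Suc m) {0<..m}" by auto
      then show ?case using Suc by simp
    qed simp
    finally show ?thesis by (simp add: N)
  qed
  moreover have "N > 0" by (simp add: N)
  ultimately have "2 ^ b l \<le> real N" "real N < 2 ^ Suc (b l)" "real N > 0"
    using of_nat_mono[of "2 ^ b l" N, where 'a = real]
      of_nat_less_iff[of N "2 ^ Suc (b l)", where 'a = real] by simp_all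
  then show ?thesis
    by (intro floor_log_eq_powr_iff[THEN iffD2]) (auto simp: powr_realpow powr_add)
qed

subsection \<open>The minimal recurrence\<close>

lemma map_poly_of_int_add:
  "map_poly of_int (p + q) = (map_poly of_int p + map_poly of_int q :: 'a::ring_1 poly)"
  by (rule poly_eqI) (simp add: coeff_map_poly)

lemma map_poly_of_int_mult:
  "map_poly of_int (p * q) = (map_poly of_int p * map_poly of_int q :: 'a::comm_ring_1 poly)"
  by (rule poly_eqI) (simp add: coeff_map_poly coeff_mult)

lemma map_poly_of_int_power:
  "map_poly of_int (p ^ n) = (map_poly of_int p ^ n :: 'a::comm_ring_1 poly)"
  by (induction n) (simp_all add: map_poly_of_int_mult)

lemma map_poly_of_int_prod:
  "map_poly of_int (\<Prod>i\<in>I. f i) = (\<Prod>i\<in>I. map_poly of_int (f i) :: 'a::comm_ring_1 poly)"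
  by (induction I rule: infinite_finite_induct) (simp_all add: map_poly_of_int_mult)

lemma exp_sum_sigma_eq_fourier:
  assumes "k < 2 ^ r"
  shows "of_int (exp_sum_sigma k n) =
    (\<Sum>z | z ^ 2 ^ r = 1. fourier_coeff (2 ^ r) (sign_binomial k) z * (1 + z) ^ n)"
proof -
  have "of_int (exp_sum_sigma k n) = (\<Sum>j\<le>n. sign_binomial k j * of_nat (n choose j))"
    by (simp add: exp_sum_sigma_def sign_binomial_def atMost_atLeast0)
  also have "\<dots> = (\<Sum>z | z ^ 2 ^ r = 1. fourier_coeff (2 ^ r) (sign_binomial k) z * (1 + z) ^ n)"
    by (rule sum_periodic_mult_binomial)
      (simp_all add: sign_binomial_eq odd_binomial_mod_power2[OF assms])
  finally show ?thesis .
qed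

text \<open>The characteristic roots of the sequence are \<open>1 + z\<close> for \<open>z\<close>
  in this set. The period \<open>2 ^ k\<close> is a convenient choice because
  \<open>k < 2 ^ k\<close>. The point -1 would give the root 0.\<close>

definition spectrum :: "nat \<Rightarrow> complex set" where
  "spectrum k = {z. z ^ 2 ^ k = 1 \<and> z \<noteq> -1 \<and> fourier_coeff (2 ^ k) (sign_binomial k) z \<noteq> 0}"

lemma finite_spectrum: "finite (spectrum k)"
  by (rule finite_subset[OF _ finite_nth_roots[of "2 ^ k" 1]]) (auto simp: spectrum_def)

lemma exp_sum_sigma_eq_spectrum:
  assumes "n \<ge> 1"
  shows "of_int (exp_sum_sigma k n) =
    (\<Sum>a\<in>(\<lambda>z. 1 + z) ` spectrum k. fourier_coeff (2 ^ k) (sign_binomial k) (a - 1) * a ^ n)"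
proof -
  have "of_int (exp_sum_sigma k n) =
      (\<Sum>z | z ^ 2 ^ k = 1. fourier_coeff (2 ^ k) (sign_binomial k) z * (1 + z) ^ n)"
    by (rule exp_sum_sigma_eq_fourier) simp
  \<comment> \<open>The dropped terms have coefficient 0 or \<open>z = -1\<close>, where
    \<open>(1 + z) ^ n = 0\<close> since \<open>n \<ge> 1\<close>.\<close>
  also have "\<dots> = (\<Sum>z\<in>spectrum k. fourier_coeff (2 ^ k) (sign_binomial k) z * (1 + z) ^ n)"
    using assms
    by (intro sum.mono_neutral_right) (auto simp: spectrum_def finite_nth_roots)
  also have "\<dots> = (\<Sum>a\<in>(\<lambda>z. 1 + z) ` spectrum k.
      fourier_coeff (2 ^ k) (sign_binomial k) (a - 1) * a ^ n)"
    by (subst sum.reindex) auto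
  finally show ?thesis .
qed

text \<open>A digit 1 of \<open>k\<close> in position \<open>b\<close> selects all roots of unity of
  order \<open>2 ^ (b + 1)\<close>. Digit 0 would select only -1, which is excluded, whence
  \<open>b \<ge> 1\<close>.\<close>

lemma spectrum_eq:
  assumes "k \<ge> 1"
  shows "spectrum k = (if \<exists>m. k = 2 ^ m then {} else {1}) \<union>
    (\<Union>b\<in>{b. b \<ge> 1 \<and> bit k b}. {z. z ^ 2 ^ b = -1})"
proof -
  \<comment> \<open>This puts the solutions of \<open>z ^ 2 ^ b = -1\<close> among the
    \<open>2 ^ k\<close>-th roots of unity.\<close>
  have lt: "b < k" if "bit k b" for b
  proof -
    have "2 ^ b \<le> k"
      using that by (metis bit_take_bit_iff less_irrefl not_le take_bit_nat_eq_self)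
    then show ?thesis by (meson less_exp less_le_trans)
  qed
  have one: "1 \<in> spectrum k \<longleftrightarrow> (\<nexists>m. k = 2 ^ m)"
    using assms fourier_coeff_sign_binomial_1_neq_0_iff[of k k] by (auto simp: spectrum_def)
  have other: "z \<in> spectrum k \<longleftrightarrow> (\<exists>b\<ge>1. bit k b \<and> z ^ 2 ^ b = -1)" if "z \<noteq> 1" for z
  proof
    assume z: "z \<in> spectrum k"
    then obtain b where b: "b < k" "z ^ 2 ^ b = -1"
      using root_unity_power2_cases[of z k] \<open>z \<noteq> 1\<close> by (auto simp: spectrum_def)
    have "bit k b"
      using z b fourier_coeff_sign_binomial_neq_0_iff[of k k z b] by (auto simp: spectrum_def)
    moreover have "b \<noteq> 0"
      using z b by (auto simp: spectrum_def intro: ccontr)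
    ultimately show "\<exists>b\<ge>1. bit k b \<and> z ^ 2 ^ b = -1"
      using b(2) by (intro exI[of _ b]) auto
  next
    assume "\<exists>b\<ge>1. bit k b \<and> z ^ 2 ^ b = -1"
    then obtain b where b: "b \<ge> 1" "bit k b" "z ^ 2 ^ b = -1" by blast
    have "z \<noteq> -1"
      using power2_power_minus_one_unique[OF b(3), of 0] b(1) by auto
    then show "z \<in> spectrum k"
      using power2_power_eq_1[OF b(3) lt[OF b(2)]] b(2) lt[OF b(2)]
        fourier_coeff_sign_binomial_neq_0_iff[of k k z b, OF _ b(3)]
      by (auto simp: spectrum_def)
  qed
  have "z \<in> spectrum k \<longleftrightarrow> z \<in> (if \<exists>m. k = 2 ^ m then {} else {1}) \<union>
    (\<Union>b\<in>{b. b \<ge> 1 \<and> bit k b}. {z. z ^ 2 ^ b = -1})" for z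
    using one other[of z] by (cases "z = 1") auto
  then show ?thesis by blast
qed

text \<open>The equations \<open>z ^ 2 ^ b = -1\<close> have \<open>2 ^ b\<close> solutions each, no
  two of them share a solution, and 1 solves none.\<close>

lemma card_spectrum:
  assumes "k \<ge> 1" "finite B" "\<And>b. b \<in> B \<longleftrightarrow> b \<ge> 1 \<and> bit k b"
  shows "card (spectrum k) = eps k + (\<Sum>b\<in>B. 2 ^ b)"
proof -
  have B: "{b. b \<ge> 1 \<and> bit k b} = B" using assms(3) by auto
  have fin: "finite {z::complex. z ^ 2 ^ b = -1}" for b
    by (rule finite_nth_roots) simp
  have "card (\<Union>b\<in>B. {z::complex. z ^ 2 ^ b = -1}) = (\<Sum>b\<in>B. 2 ^ b)"
    using assms(2) fin power2_power_minus_one_unique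
    by (subst card_UN_disjoint) (auto simp: card_nth_roots)
  then show ?thesis
    unfolding spectrum_eq[OF assms(1)] B
    using assms(2) fin by (subst card_Un_disjoint) (auto simp: eps_def)
qed

text \<open>Both sides are monic of the same degree, and at \<open>1 + z\<close> the polynomial
  \<open>x - 1\<close> takes the value \<open>z\<close>, so the left side vanishes there.\<close>

lemma prod_spectrum:
  assumes "k \<ge> 1" "finite B" "\<And>b. b \<in> B \<longleftrightarrow> b \<ge> 1 \<and> bit k b"
  shows "[:-2, 1:] ^ eps k * (\<Prod>b\<in>B. [:-1, 1:] ^ 2 ^ b + 1) =
    (\<Prod>a\<in>(\<lambda>z. 1 + z) ` spectrum k. [:-a, 1:])" (is "?R = _")
proof (rule monic_eq_prod_linear)
  show "finite ((\<lambda>z. 1 + z) ` spectrum k)"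
    by (simp add: finite_spectrum)
  have factor: "lead_coeff ([:-1, 1::complex:] ^ 2 ^ b + 1) = 1" for b
    by (rule lead_coeff_linear_power_add_1) simp
  show "lead_coeff ?R = 1"
    by (simp only: lead_coeff_mult lead_coeff_power lead_coeff_prod factor prod.neutral_const) simp
  have nz: "[:-1, 1::complex:] ^ 2 ^ b + 1 \<noteq> 0" for b
    using factor[of b] by (metis leading_coeff_0_iff zero_neq_one)
  then have "degree ?R = eps k + (\<Sum>b\<in>B. 2 ^ b)"
    using assms(2)
    by (simp add: degree_mult_eq degree_linear_power degree_prod_sum_eq degree_linear_power_add_1)
  also have "\<dots> = card ((\<lambda>z. 1 + z) ` spectrum k)"
    using card_spectrum[OF assms] by (simp add: card_image)
  finally show "degree ?R = card ((\<lambda>z. 1 + z) ` spectrum k)" .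
  fix a assume "a \<in> (\<lambda>z. 1 + z) ` spectrum k"
  then obtain z where z: "a = 1 + z" "z \<in> spectrum k" by blast
  have "{b. b \<ge> 1 \<and> bit k b} = B"
    using assms(3) by auto
  then show "poly ?R a = 0"
    using z(2) assms(2) unfolding spectrum_eq[OF assms(1)]
    by (auto simp: z(1) poly_prod eps_def add_eq_0_iff2 split: if_splits)
qed

text \<open>Provides the integer polynomial whose complex roots are the characteristic
  roots.\<close>

lemma map_poly_of_int_eq_prod_spectrum:
  assumes "k \<ge> 1" "finite B" "\<And>b. b \<in> B \<longleftrightarrow> b \<ge> 1 \<and> bit k b"
  shows "map_poly of_int ([:-2, 1:] ^ eps k * (\<Prod>b\<in>B. [:-1, 1:] ^ 2 ^ b + 1)) =
    (\<Prod>a\<in>(\<lambda>z. 1 + z) ` spectrum k. [:-a, 1:])"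
  unfolding prod_spectrum[OF assms, symmetric]
  by (simp add: map_poly_of_int_mult map_poly_of_int_power map_poly_of_int_prod
      map_poly_of_int_add map_poly_pCons)

text \<open>For \<open>k = 1\<close> the expansion is empty: \<open>l = 0\<close>, the sequence
  vanishes for \<open>n \<ge> 1\<close>, and the minimal recurrence has order 0 and polynomial
  1.\<close>

theorem mainTheorem3:
  fixes k kbar l :: nat and a :: "nat \<Rightarrow> nat"
  assumes "k \<ge> 1"
    and "kbar = 2 * (k div 2) + 1"
    and "odd_binary_expansion kbar l a"
  shows "(l \<ge> 1 \<longrightarrow> int (a l) = \<lfloor>log 2 (real kbar)\<rfloor>) \<and>
    (\<exists>D c. minimal_recurrence (exp_sum_sigma k) D c) \<and>
    (\<forall>D c. minimal_recurrence (exp_sum_sigma k) D c \<longrightarrow>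
       map_poly of_int (recurrence_char_poly D c) =
         [:-2, 1:] ^ eps k * (\<Prod>j=1..l. pcompose (cyclotomic_poly (2 ^ (a j + 1))) [:-1, 1:]) \<and>
       D = 2 * (k div 2) + eps k)"
proof -
  define B where "B = a ` {1..l}"
  have inj: "inj_on a {1..l}" and pos: "\<And>b. b \<in> B \<Longrightarrow> b \<ge> 1"
    and sum_a: "kbar = 1 + (\<Sum>j=1..l. 2 ^ a j)"
    using assms(3) by (auto simp: odd_binary_expansion_def B_def dest: strict_mono_on_imp_inj_on)
  have [simp]: "finite B" by (simp add: B_def)
  have sum_B: "(\<Sum>b\<in>B. 2 ^ b) = 2 * (k div 2)"
    using assms(2) sum_a inj by (simp add: B_def sum.reindex)
  \<comment> \<open>\<open>B\<close> holds the positions of the digits 1 of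
    \<open>2 * (k div 2)\<close>, which differs from \<open>k\<close> at most in digit 0.\<close>
  have bits: "b \<in> B \<longleftrightarrow> b \<ge> 1 \<and> bit k b" for b
  proof (cases b)
    case (Suc c)
    have "b \<in> B \<longleftrightarrow> bit (2 * (k div 2)) b"
      unfolding sum_B[symmetric] by (simp add: bit_sum_power2)
    then show ?thesis by (simp add: Suc bit_Suc)
  qed (use pos in auto)
  note B = \<open>k \<ge> 1\<close> \<open>finite B\<close> bits
  \<comment> \<open>A root 0 could only come from \<open>z = -1\<close>.\<close>
  have nonzero: "0 \<notin> (\<lambda>z. 1 + z) ` spectrum k"
    by (auto simp: spectrum_def add_eq_0_iff)
  note minimal = minimal_recurrence_exponential_sum
    [where A = "(\<lambda>z. 1 + z) ` spectrum k" and x = "exp_sum_sigma k"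
      and d = "\<lambda>a. fourier_coeff (2 ^ k) (sign_binomial k) (a - 1)",
      OF finite_imageI[OF finite_spectrum] nonzero _ exp_sum_sigma_eq_spectrum
        map_poly_of_int_eq_prod_spectrum[OF B]]
  have coeff: "fourier_coeff (2 ^ k) (sign_binomial k) (a - 1) \<noteq> 0"
    if "a \<in> (\<lambda>z. 1 + z) ` spectrum k" for a
    using that by (auto simp: spectrum_def)
  have rhs: "[:-2, 1:] ^ eps k * (\<Prod>j=1..l. pcompose (cyclotomic_poly (2 ^ (a j + 1))) [:-1, 1:]) =
      (\<Prod>a\<in>(\<lambda>z. 1 + z) ` spectrum k. [:-a, 1:])"
  proof -
    have "(\<Prod>j=1..l. pcompose (cyclotomic_poly (2 ^ (a j + 1))) [:-1, 1:]) =
        (\<Prod>b\<in>B. [:-1, 1:] ^ 2 ^ b + 1)"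
      unfolding B_def prod.reindex[OF inj] using cyclotomic_poly_power2_shift by simp
    then show ?thesis using prod_spectrum[OF B] by simp
  qed
  have card: "card ((\<lambda>z. 1 + z) ` spectrum k) = 2 * (k div 2) + eps k"
    using card_spectrum[OF B] sum_B by (simp add: card_image)
  show ?thesis
    unfolding rhs card[symmetric]
    using floor_log2_binary_expansion[OF assms(3)] minimal[OF coeff] by auto
qed

end
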